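(* Let $\sigma>0$ and $1\le p\le q\le\infty$. Then the following continuous embeddings hold: $$B^1_\sigma\subset B^p_\sigma\subset B^q_\sigma\subset B^\infty_\sigma,$$ where each $B^r_\sigma$ carries the norm of $L_r(\mathbb{R})$.
   Context: For $\sigma>0$ and $1\le p\le\infty$, the Bernstein space $B^p_\sigma$ is the set of all $f\in L_p(\mathbb{R})\cap C^\infty(\mathbb{R})$ (complex-valued) whose distributional Fourier transform has support in $[-\sigma,\sigma]$. The Fourier transform is $\mathcal{F}\varphi(\xi)=\frac{1}{\sqrt{2\pi}}\int_{\mathbb{R}}\varphi(x)e^{-ix\xi}dx$ for Schwartz functions $\varphi$, extended to tempered distributions by duality. *)

theory Defs
  imports "HOL-Analysis.Analysis" "HOL-Probability.Essential_Supremum"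
begin

definition vderiv_n :: "nat \<Rightarrow> (real \<Rightarrow> complex) \<Rightarrow> real \<Rightarrow> complex" where
  "vderiv_n n f = ((\<lambda>g x. vector_derivative g (at x)) ^^ n) f"

definition smooth :: "(real \<Rightarrow> complex) \<Rightarrow> bool" where
  "smooth f \<longleftrightarrow> (\<forall>n x. vderiv_n n f differentiable (at x))"

text \<open>The exponent ranges over \<open>ennreal\<close>, so that \<open>p = \<infinity>\<close> is admitted. Elements of \<open>L_p\<close>
  are functions rather than classes modulo null sets: below they are always smooth, and two
  continuous functions that agree almost everywhere are equal. For the same reason Borel
  measurability suffices.\<close>

definition Lp_space :: "ennreal \<Rightarrow> (real \<Rightarrow> complex) set" where
  "Lp_space p = {f \<in> borel_measurable lborel.
     if p = \<infinity> then esssup lborel (\<lambda>x. ennreal (norm (f x))) < \<infinity>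
     else integrable lborel (\<lambda>x. norm (f x) powr enn2real p)}"

definition Lp_norm :: "ennreal \<Rightarrow> (real \<Rightarrow> complex) \<Rightarrow> real" where
  "Lp_norm p f =
     (if p = \<infinity> then enn2real (esssup lborel (\<lambda>x. ennreal (norm (f x))))
      else (\<integral>x. norm (f x) powr enn2real p \<partial>lborel) powr (1 / enn2real p))"

definition schwartz :: "(real \<Rightarrow> complex) set" where
  "schwartz = {\<phi>. smooth \<phi> \<and> (\<forall>m n. bounded (range (\<lambda>x. x ^ m *\<^sub>R vderiv_n n \<phi> x)))}"

definition test_functions :: "real set \<Rightarrow> (real \<Rightarrow> complex) set" where
  "test_functions U = {\<phi>. smooth \<phi> \<and> compact (closure (support_on UNIV \<phi>))
                          \<and> closure (support_on UNIV \<phi>) \<subseteq> U}"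

definition fourier :: "(real \<Rightarrow> complex) \<Rightarrow> real \<Rightarrow> complex" where
  "fourier \<phi> \<xi> = complex_of_real (1 / sqrt (2 * pi)) *
     (\<integral>x. \<phi> x * exp (- (\<i> * complex_of_real (x * \<xi>))) \<partial>lborel)"

text \<open>A tempered distribution is represented by a functional on \<^typ>\<open>real \<Rightarrow> complex\<close>, of which
  only the values on \<^const>\<open>schwartz\<close> matter.\<close>

definition function_distr :: "(real \<Rightarrow> complex) \<Rightarrow> (real \<Rightarrow> complex) \<Rightarrow> complex" where
  "function_distr f \<phi> = (\<integral>x. f x * \<phi> x \<partial>lborel)"

definition fourier_distr :: "((real \<Rightarrow> complex) \<Rightarrow> complex) \<Rightarrow> (real \<Rightarrow> complex) \<Rightarrow> complex" where
  "fourier_distr T \<phi> = T (fourier \<phi>)"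

definition supp_distr :: "((real \<Rightarrow> complex) \<Rightarrow> complex) \<Rightarrow> real set" where
  "supp_distr T = - \<Union>{U. open U \<and> (\<forall>\<phi>\<in>test_functions U. T \<phi> = 0)}"

definition bernstein :: "ennreal \<Rightarrow> real \<Rightarrow> (real \<Rightarrow> complex) set" where
  "bernstein p \<sigma> = {f \<in> Lp_space p. smooth f \<and>
     supp_distr (fourier_distr (function_distr f)) \<subseteq> {-\<sigma>..\<sigma>}}"

text \<open>For linear subspaces \<open>X\<close>, \<open>Y\<close> of a function space with norms \<open>NX\<close>, \<open>NY\<close>: the inclusion
  map is a bounded linear operator.\<close>

definition continuously_embedded ::
    "'a set \<Rightarrow> ('a \<Rightarrow> real) \<Rightarrow> 'a set \<Rightarrow> ('a \<Rightarrow> real) \<Rightarrow> bool" where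
  "continuously_embedded X NX Y NY \<longleftrightarrow> X \<subseteq> Y \<and> (\<exists>C. \<forall>f\<in>X. NY f \<le> C * NX f)"

end

theory Submission
  imports Defs "HOL-Probability.Characteristic_Functions" "HOL-Probability.Sinc_Integral"
begin

text \<open>A band-limited \<open>f\<close> is reproduced by convolution with the Fourier transform of a cutoff that equals
  \<open>1\<close> near \<open>{-\<sigma>..\<sigma>}\<close>. This transform decays like \<open>1 / (1 + x\<^sup>2)\<close>, so \<open>\<bar>f\<bar>\<close> is bounded by a
  constant times its \<open>L_p\<close> norm for finite \<open>p\<close>; interpolating
  \<open>\<bar>f\<bar>\<^sup>q \<le> (sup \<bar>f\<bar>)\<^sup>q\<^sup>-\<^sup>p \<bar>f\<bar>\<^sup>p\<close> gives every other embedding.\<close>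

section \<open>Smooth functions and cutoffs\<close>

text \<open>For large p the transform of \<open>f\<close> is only a distribution, so no inversion
  theorem for functions applies to \<open>f\<close> itself. Inversion is therefore done on the side
  of the test functions: some are chosen whose transforms concentrate at a point \<open>x0\<close>,
  their pairings with \<open>f\<close> tend to a multiple of \<open>f x0\<close>, and the support
  condition makes these pairings eventually constant. The support condition is local, being stated
  through open sets on which the distribution vanishes, so it has to be made global on a compact
  interval before it can be used. Decay of order two comes from two integrations by parts and is
  enough: \<open>1 / (1 + x\<^sup>2)\<close> is bounded and integrable, hence pairs with every L_p.
  The pointwise constant depends only on \<sigma>, because the cutoff is fixed from \<sigma> alone.
  For p = \<infinity> nothing has to be estimated, since then q = \<infinity> as well.\<close>

lemma smooth_coinduct:
  assumes "f \<in> S"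
    and step: "\<And>g. g \<in> S \<Longrightarrow> \<exists>g'\<in>S. \<forall>x. (g has_vector_derivative g' x) (at x)"
  shows "smooth f"
proof -
  \<comment> \<open>This invariance replaces formulas for n-th derivatives: each closure property
    below only needs a family that is closed under one differentiation.\<close>
  have "vderiv_n n f \<in> S" for n
  proof (induction n)
    case 0
    then show ?case using assms(1) by (simp add: vderiv_n_def)
  next
    case (Suc n)
    from step[OF Suc] obtain g' where g': "g' \<in> S" "\<And>x. (vderiv_n n f has_vector_derivative g' x) (at x)"
      by blast
    then have "(\<lambda>x. vector_derivative (vderiv_n n f) (at x)) = g'"
      by (intro ext vector_derivative_at) auto
    then show ?case using g'(1) by (simp add: vderiv_n_def)
  qed
  then show ?thesis
    using step unfolding smooth_def by (blast intro: differentiableI_vector)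
qed

lemma smooth_has_vector_derivative:
  assumes "smooth f"
  shows "(f has_vector_derivative vector_derivative f (at x)) (at x)"
proof -
  have "vderiv_n 0 f differentiable (at x)"
    using assms unfolding smooth_def by blast
  then show ?thesis
    by (simp add: vderiv_n_def vector_derivative_works[symmetric])
qed

lemma smooth_vector_derivative:
  assumes "smooth f"
  shows "smooth (\<lambda>x. vector_derivative f (at x))"
  unfolding smooth_def
proof (intro allI)
  fix n x
  have "vderiv_n n (\<lambda>x. vector_derivative f (at x)) = vderiv_n (Suc n) f"
    unfolding vderiv_n_def funpow_Suc_right by simp
  then show "vderiv_n n (\<lambda>x. vector_derivative f (at x)) differentiable (at x)"
    using assms unfolding smooth_def by simp
qed

lemma smooth_continuous_on: "smooth f \<Longrightarrow> continuous_on A f"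
  by (intro continuous_at_imp_continuous_on ballI
      has_vector_derivative_continuous[OF smooth_has_vector_derivative])

lemma smooth_measurable: "smooth f \<Longrightarrow> f \<in> borel_measurable borel"
  by (intro borel_measurable_continuous_onI smooth_continuous_on)

text \<open>The derivative of a product is a sum of products, so the single products are no suitable
  family for \<open>smooth_coinduct\<close>. The algebra generated by the smooth functions is one,
  and Leibniz's formula is avoided.\<close>

inductive_set smooth_alg :: "(real \<Rightarrow> complex) set" where
  base: "smooth f \<Longrightarrow> f \<in> smooth_alg"
| add: "f \<in> smooth_alg \<Longrightarrow> g \<in> smooth_alg \<Longrightarrow> (\<lambda>x. f x + g x) \<in> smooth_alg"
| mult: "f \<in> smooth_alg \<Longrightarrow> g \<in> smooth_alg \<Longrightarrow> (\<lambda>x. f x * g x) \<in> smooth_alg"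

lemma smooth_alg_smooth:
  assumes "f \<in> smooth_alg" shows "smooth f"
proof (rule smooth_coinduct[OF assms])
  fix g assume "g \<in> smooth_alg"
  then show "\<exists>g'\<in>smooth_alg. \<forall>x. (g has_vector_derivative g' x) (at x)"
  proof (induction g)
    case (base f)
    show ?case
      using base
      by (intro bexI[of _ "\<lambda>x. vector_derivative f (at x)"] allI
          smooth_has_vector_derivative smooth_alg.base smooth_vector_derivative)
  next
    case (add f g)
    then obtain f' g' where *: "f' \<in> smooth_alg" "g' \<in> smooth_alg"
      "\<And>x. (f has_vector_derivative f' x) (at x)" "\<And>x. (g has_vector_derivative g' x) (at x)"
      by blast
    show ?case
      by (intro bexI[of _ "\<lambda>x. f' x + g' x"] allI has_vector_derivative_add smooth_alg.add *)
  next
    case (mult f g)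
    then obtain f' g' where *: "f' \<in> smooth_alg" "g' \<in> smooth_alg"
      "\<And>x. (f has_vector_derivative f' x) (at x)" "\<And>x. (g has_vector_derivative g' x) (at x)"
      by blast
    show ?case
      by (intro bexI[of _ "\<lambda>x. f x * g' x + f' x * g x"] allI has_vector_derivative_mult
          smooth_alg.add smooth_alg.mult * mult.hyps)
  qed
qed

lemma smooth_add: "smooth f \<Longrightarrow> smooth g \<Longrightarrow> smooth (\<lambda>x. f x + g x)"
  by (rule smooth_alg_smooth[OF smooth_alg.add[OF smooth_alg.base smooth_alg.base]])

lemma smooth_mult: "smooth f \<Longrightarrow> smooth g \<Longrightarrow> smooth (\<lambda>x. f x * g x)"
  by (rule smooth_alg_smooth[OF smooth_alg.mult[OF smooth_alg.base smooth_alg.base]])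

lemma smooth_exp_linear: "smooth (\<lambda>x. exp (c * complex_of_real x))"
proof (rule smooth_coinduct)
  show "(\<lambda>x. exp (c * complex_of_real x)) \<in> range (\<lambda>k x. k * exp (c * complex_of_real x))"
    by (rule range_eqI[of _ _ 1]) auto
next
  fix g assume "g \<in> range (\<lambda>k x. k * exp (c * complex_of_real x))"
  then obtain k where g: "g = (\<lambda>x. k * exp (c * complex_of_real x))" by auto
  have "(g has_vector_derivative (k * c) * exp (c * complex_of_real x)) (at x)" for x
    unfolding g
    by (rule has_vector_derivative_eq_rhs, rule has_vector_derivative_real_field)
      (auto intro!: derivative_eq_intros)
  then show "\<exists>g'\<in>range (\<lambda>k x. k * exp (c * complex_of_real x)). \<forall>x. (g has_vector_derivative g' x) (at x)"
    by (intro bexI[of _ "\<lambda>x. (k * c) * exp (c * complex_of_real x)"] allI range_eqI[of _ _ "k * c"]) auto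
qed

lemma smooth_const: "smooth (\<lambda>_. c)"
proof (rule smooth_coinduct[of _ "range (\<lambda>c _. c)"])
  fix g :: "real \<Rightarrow> complex" assume "g \<in> range (\<lambda>c _. c)"
  then show "\<exists>g'\<in>range (\<lambda>c _. c). \<forall>x. (g has_vector_derivative g' x) (at x)"
    by (intro bexI[of _ "\<lambda>_. 0"]) auto
qed auto

lemma smooth_diff: "smooth f \<Longrightarrow> smooth g \<Longrightarrow> smooth (\<lambda>x. f x - g x)"
  using smooth_add[OF _ smooth_mult[OF smooth_const[of "-1"]], of f g] by simp

lemma smooth_affine:
  assumes "smooth f" shows "smooth (\<lambda>x. f (a * x + b))"
proof (rule smooth_coinduct)
  \<comment> \<open>The scalar \<open>c\<close> absorbs the factor \<open>a\<close> that the chain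
    rule produces at each differentiation.\<close>
  let ?S = "{\<lambda>x. c * f (a * x + b) |c f. smooth f}"
  show "(\<lambda>x. f (a * x + b)) \<in> ?S"
    using assms by (intro CollectI exI[of _ 1] exI[of _ f]) simp
  fix g assume "g \<in> ?S"
  then obtain c f where g: "g = (\<lambda>x. c * f (a * x + b))" and f: "smooth f" by auto
  let ?g' = "\<lambda>x. (c * of_real a) * vector_derivative f (at (a * x + b))"
  have "(g has_vector_derivative ?g' x) (at x)" for x
  proof -
    have "((\<lambda>x. a * x + b) has_vector_derivative a) (at x)"
      unfolding has_real_derivative_iff_has_vector_derivative[symmetric]
      by (auto intro!: derivative_eq_intros)
    from vector_diff_chain_at[OF this smooth_has_vector_derivative[OF f]]
    have "((\<lambda>x. f (a * x + b)) has_vector_derivative a *\<^sub>R vector_derivative f (at (a * x + b))) (at x)"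
      by (simp add: o_def)
    from has_vector_derivative_mult_right[OF this, of c] show ?thesis
      unfolding g by (simp add: scaleR_conv_of_real mult.assoc)
  qed
  moreover have "?g' \<in> ?S"
    using smooth_vector_derivative[OF f]
    by (intro CollectI exI[of _ "c * of_real a"] exI[of _ "\<lambda>x. vector_derivative f (at x)"]) simp
  ultimately show "\<exists>g'\<in>?S. \<forall>x. (g has_vector_derivative g' x) (at x)"
    by (intro bexI[of _ ?g'] allI)
qed

text \<open>The quotients \<open>u / g ^ n\<close> with smooth \<open>u\<close> form a family closed
  under differentiation: the new numerator is \<open>u' g - n u g'\<close>, the new exponent
  \<open>n + 1\<close>.\<close>

lemma smooth_inverse:
  assumes g: "smooth g" and nz: "\<And>x. g x \<noteq> 0"
  shows "smooth (\<lambda>x. inverse (g x))"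
proof (rule smooth_coinduct)
  let ?S = "{\<lambda>x. u x * inverse (g x) ^ n |u n. smooth u}"
  show "(\<lambda>x. inverse (g x)) \<in> ?S"
    using smooth_const[of 1] by (intro CollectI exI[of _ "\<lambda>_. 1"] exI[of _ "1::nat"]) simp
  fix h assume "h \<in> ?S"
  then obtain u n where h: "h = (\<lambda>x. u x * inverse (g x) ^ n)" and u: "smooth u" by auto
  let ?v = "\<lambda>x. vector_derivative u (at x) * g x - of_nat n * u x * vector_derivative g (at x)"
  have "(h has_vector_derivative ?v x * inverse (g x) ^ Suc n) (at x)" for x
  proof -
    have inv: "inverse (g x) ^ n = g x * inverse (g x) ^ Suc n"
      using nz[of x] by simp
    have "((\<lambda>y. inverse y ^ n) has_field_derivative
        (of_nat n * inverse (g x) ^ (n - 1) * - (inverse (g x) * inverse (g x)))) (at (g x))"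
      using nz[of x] by (auto intro!: derivative_eq_intros)
    \<comment> \<open>For \<open>n = 0\<close> both sides vanish through the factor
      \<open>of_nat n\<close>, so the truncated \<open>n - 1\<close> does no harm.\<close>
    also have "of_nat n * inverse (g x) ^ (n - 1) * - (inverse (g x) * inverse (g x))
        = - (of_nat n * inverse (g x) ^ Suc n)"
      by (cases n) (auto simp: algebra_simps)
    finally have "((\<lambda>x. inverse (g x) ^ n) has_vector_derivative
        vector_derivative g (at x) * - (of_nat n * inverse (g x) ^ Suc n)) (at x)"
      using field_vector_diff_chain_at[OF smooth_has_vector_derivative[OF g], where g="\<lambda>y. inverse y ^ n"]
      unfolding o_def by blast
    from has_vector_derivative_mult[OF smooth_has_vector_derivative[OF u] this]
    show ?thesis unfolding h
      by (rule has_vector_derivative_eq_rhs) (subst inv, algebra)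
  qed
  moreover have "smooth ?v"
    by (intro smooth_diff smooth_mult smooth_const smooth_vector_derivative g u)
  ultimately show "\<exists>g'\<in>?S. \<forall>x. (h has_vector_derivative g' x) (at x)"
    by (intro bexI[of _ "\<lambda>x. ?v x * inverse (g x) ^ Suc n"] allI CollectI exI[of _ ?v] exI[of _ "Suc n"])
      simp_all
qed

section \<open>Smooth steps built from the flat function exp(-1/x)\<close>

lemma poly_over_exp_tendsto_0: "((\<lambda>y. poly p y * exp (- y)) \<longlongrightarrow> (0::real)) at_top"
proof -
  have "((\<lambda>y. \<Sum>i\<le>degree p. coeff p i * (y ^ i / exp y)) \<longlongrightarrow> (\<Sum>i\<le>degree p. coeff p i * 0)) at_top"
    by (intro tendsto_intros tendsto_power_div_exp_0)
  then show ?thesis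
    by (simp add: poly_altdef sum_distrib_right exp_minus divide_inverse mult.assoc)
qed

text \<open>For \<open>p = 1\<close> this is the classical flat function. The polynomial in 1/x is
  carried along because every derivative of exp(-1/x) has this shape.\<close>

definition flat_poly :: "real poly \<Rightarrow> real \<Rightarrow> real" where
  "flat_poly p x = (if x > 0 then poly p (inverse x) * exp (- inverse x) else 0)"

text \<open>With \<open>y = 1/x\<close> one has \<open>dy/dx = - y\<^sup>2\<close>, so
  \<open>p y * exp (- y)\<close> has derivative \<open>y\<^sup>2 * (p y - p' y) * exp (- y)\<close>;
  this explains the polynomial on the right. At the origin the exponential beats every power of
  \<open>y\<close>.\<close>

lemma flat_poly_deriv:
  "(flat_poly p has_real_derivative flat_poly (monom 1 2 * (p - pderiv p)) x) (at x)"
proof (cases x "0::real" rule: linorder_cases)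
  case less
  have "((\<lambda>_. 0) has_real_derivative 0) (at x)" by simp
  then have "(flat_poly p has_real_derivative 0) (at x)"
    by (rule has_field_derivative_transform_within_open[of _ _ _ "{..<0}"])
      (use less in \<open>auto simp: flat_poly_def\<close>)
  then show ?thesis using less by (simp add: flat_poly_def)
next
  case greater
  have "((\<lambda>x. poly p (inverse x) * exp (- inverse x)) has_real_derivative
      poly (monom 1 2 * (p - pderiv p)) (inverse x) * exp (- inverse x)) (at x)"
    using greater
    by (auto intro!: derivative_eq_intros DERIV_chain2[OF poly_DERIV]
        simp: poly_monom power2_eq_square algebra_simps)
  then have "(flat_poly p has_real_derivative
      poly (monom 1 2 * (p - pderiv p)) (inverse x) * exp (- inverse x)) (at x)"
    by (rule has_field_derivative_transform_within_open[of _ _ _ "{0<..}"])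
      (use greater in \<open>auto simp: flat_poly_def\<close>)
  then show ?thesis using greater by (simp add: flat_poly_def)
next
  case equal
  \<comment> \<open>On the left the difference quotient is zero; on the right division by
    \<open>h\<close> multiplies the polynomial in \<open>1/h\<close> by its variable.\<close>
  have "((\<lambda>h. flat_poly p h / h) \<longlongrightarrow> 0) (at 0)"
  proof (rule filterlim_split_at)
    have "eventually (\<lambda>h. 0 = flat_poly p h / h) (at_left 0)"
      by (auto simp: eventually_at_filter flat_poly_def)
    then show "((\<lambda>h. flat_poly p h / h) \<longlongrightarrow> 0) (at_left 0)"
      by (rule tendsto_eventually[OF eventually_mono]) auto
    have "((\<lambda>h. poly (monom 1 1 * p) (inverse h) * exp (- inverse h)) \<longlongrightarrow> (0::real)) (at_right 0)"
      by (rule filterlim_compose[OF poly_over_exp_tendsto_0 filterlim_inverse_at_top_right])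
    moreover have "eventually (\<lambda>h. poly (monom 1 1 * p) (inverse h) * exp (- inverse h) = flat_poly p h / h)
        (at_right 0)"
      by (auto simp: eventually_at_filter flat_poly_def poly_monom field_simps)
    ultimately show "((\<lambda>h. flat_poly p h / h) \<longlongrightarrow> 0) (at_right 0)"
      by (rule Lim_transform_eventually)
  qed
  then show ?thesis using equal
    by (simp add: DERIV_def flat_poly_def)
qed

lemma smooth_flat_poly: "smooth (\<lambda>x. of_real (flat_poly p x))"
proof (rule smooth_coinduct)
  let ?S = "range (\<lambda>p x. complex_of_real (flat_poly p x))"
  show "(\<lambda>x. of_real (flat_poly p x)) \<in> ?S" by blast
  fix g assume "g \<in> ?S"
  then obtain p where g: "g = (\<lambda>x. of_real (flat_poly p x))" by blast
  have "(g has_vector_derivative of_real (flat_poly (monom 1 2 * (p - pderiv p)) x)) (at x)" for x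
    unfolding g using flat_poly_deriv[of p x]
    by (intro has_vector_derivative_of_real) (simp add: has_real_derivative_iff_has_vector_derivative)
  then show "\<exists>g'\<in>?S. \<forall>x. (g has_vector_derivative g' x) (at x)"
    by (intro bexI[of _ "\<lambda>x. of_real (flat_poly (monom 1 2 * (p - pderiv p)) x)"] allI
        range_eqI[of _ _ "monom 1 2 * (p - pderiv p)"]) auto
qed

text \<open>The quotient \<open>h x / (h x + h (1 - x))\<close> of flat functions works: the
  denominator is positive because \<open>x\<close> or \<open>1 - x\<close> is. The argument is
  written \<open>(-1) * x + 1\<close> to match \<open>smooth_affine\<close>.\<close>

lemma smooth_step_exists:
  obtains s where "smooth s" "\<And>x. x \<le> 0 \<Longrightarrow> s x = 0" "\<And>x. x \<ge> 1 \<Longrightarrow> s x = 1"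
proof
  let ?h = "flat_poly 1"
  let ?g = "\<lambda>x. complex_of_real (?h x) + complex_of_real (?h ((-1) * x + 1))"
  let ?s = "\<lambda>x. complex_of_real (?h x) * inverse (?g x)"
  have "?h x \<ge> 0" "x > 0 \<Longrightarrow> ?h x > 0" for x
    by (auto simp: flat_poly_def)
  then have "?h x + ?h ((-1) * x + 1) > 0" for x
    by (cases "x > 0") (auto intro: add_pos_nonneg add_nonneg_pos)
  then have "?g x \<noteq> 0" for x
    by (metis less_irrefl of_real_0 of_real_add of_real_eq_iff)
  then show "smooth ?s"
    by (intro smooth_mult smooth_inverse smooth_add smooth_affine[of "\<lambda>x. of_real (flat_poly 1 x)"]
        smooth_flat_poly) auto
  show "?s x = 0" if "x \<le> 0" for x
    using that by (simp add: flat_poly_def)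
  show "?s x = 1" if "x \<ge> 1" for x
    using that by (simp add: flat_poly_def)
qed

lemma smooth_cutoff_exists:
  assumes "r < R"
  obtains u where "smooth u" "\<And>x. x \<le> r \<Longrightarrow> u x = 0" "\<And>x. x \<ge> R \<Longrightarrow> u x = 1"
proof -
  obtain s where s: "smooth s" "\<And>x. x \<le> 0 \<Longrightarrow> s x = 0" "\<And>x. x \<ge> 1 \<Longrightarrow> s x = 1"
    by (rule smooth_step_exists) blast
  have "1 / (R - r) * x + - r / (R - r) = (x - r) / (R - r)" for x
    by (simp add: diff_divide_distrib)
  then have "smooth (\<lambda>x. s ((x - r) / (R - r)))"
    using smooth_affine[OF s(1), of "1 / (R - r)" "- r / (R - r)"] by simp
  then show ?thesis
    by (rule that) (use assms in \<open>auto intro!: s simp: divide_le_0_iff le_divide_eq_1\<close>)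
qed

section \<open>Test functions and supports of distributions\<close>

lemma test_functionsI:
  assumes "smooth \<phi>" "\<And>x. x \<notin> {a..b} \<Longrightarrow> \<phi> x = 0" "{a..b} \<subseteq> U"
  shows "\<phi> \<in> test_functions U"
proof -
  have "closure (support_on UNIV \<phi>) \<subseteq> {a..b}"
    by (rule closure_minimal) (use assms(2) in \<open>auto simp: support_on_def simp del: atLeastAtMost_iff\<close>)
  moreover from this have "compact (closure (support_on UNIV \<phi>))"
    by (meson bounded_closed_interval bounded_subset closed_closure compact_eq_bounded_closed)
  ultimately show ?thesis
    using assms(1,3) by (auto simp: test_functions_def)
qed

lemma test_functions_support:
  assumes "\<phi> \<in> test_functions U"
  obtains a b where "smooth \<phi>" "support_on UNIV \<phi> \<subseteq> {a..b}"
proof -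
  have "bounded (support_on UNIV \<phi>)"
    using assms by (auto simp: test_functions_def intro: bounded_subset[OF compact_imp_bounded closure_subset])
  then obtain a where "support_on UNIV \<phi> \<subseteq> cbox (- a) a"
    by (rule bounded_subset_cbox_symmetric)
  then show ?thesis
    using assms that[of "- a" a] by (auto simp: test_functions_def)
qed

text \<open>Bisection replaces a partition of unity: two adjacent intervals are glued by one smooth step.\<close>

lemma supp_distr_vanish_interval:
  assumes add: "\<And>\<phi> \<psi>. \<phi> \<in> test_functions UNIV \<Longrightarrow> \<psi> \<in> test_functions UNIV \<Longrightarrow>
      T (\<lambda>x. \<phi> x + \<psi> x) = T \<phi> + T \<psi>"
    and disj: "{a..b} \<inter> supp_distr T = {}" and "a \<le> b"
    and \<phi>: "smooth \<phi>" "\<And>x. x \<notin> {a..b} \<Longrightarrow> \<phi> x = 0"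
  shows "T \<phi> = 0"
proof -
  \<comment> \<open>The margin \<open>e\<close> strengthens the claim so that adjacent intervals
    overlap and leave room for the transition of a smooth step.\<close>
  define P where "P a b \<longleftrightarrow> (\<exists>e>0. \<forall>\<phi>. smooth \<phi> \<and> (\<forall>x. x \<notin> {a-e..b+e} \<longrightarrow> \<phi> x = 0) \<longrightarrow> T \<phi> = 0)"
    for a b
  have "P a b" using \<open>a \<le> b\<close>
  proof (induction rule: Bolzano)
    case (trans a b c)
    then obtain e1 e2 where e: "e1 > 0" "e2 > 0"
      and e1: "\<And>\<phi>. smooth \<phi> \<Longrightarrow> (\<And>x. x \<notin> {a-e1..b+e1} \<Longrightarrow> \<phi> x = 0) \<Longrightarrow> T \<phi> = 0"
      and e2: "\<And>\<phi>. smooth \<phi> \<Longrightarrow> (\<And>x. x \<notin> {b-e2..c+e2} \<Longrightarrow> \<phi> x = 0) \<Longrightarrow> T \<phi> = 0"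
      unfolding P_def by metis
    define e where "e = min e1 e2"
    have epos: "e > 0" "e \<le> e1" "e \<le> e2" using e by (auto simp: e_def)
    \<comment> \<open>The piece \<open>\<phi> * u\<close> lives on \<open>{b..c+e}\<close> and
      \<open>\<phi> * (1 - u)\<close> on \<open>{a-e..b+e}\<close>, so each falls under one of the
      two hypotheses.\<close>
    obtain u where u: "smooth u" "\<And>x. x \<le> b \<Longrightarrow> u x = 0" "\<And>x. x \<ge> b + e \<Longrightarrow> u x = 1"
      by (rule smooth_cutoff_exists[of b "b + e"]) (use epos in auto)
    show ?case unfolding P_def
    proof (intro exI[of _ e] conjI epos allI impI, elim conjE)
      fix \<phi> assume \<phi>: "smooth \<phi>" and z: "\<forall>x. x \<notin> {a-e..c+e} \<longrightarrow> \<phi> x = 0"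
      have sm: "smooth (\<lambda>x. \<phi> x * u x)" "smooth (\<lambda>x. \<phi> x * (1 - u x))"
        by (intro smooth_mult smooth_diff smooth_const \<phi> u)+
      have "T \<phi> = T (\<lambda>x. \<phi> x * u x + \<phi> x * (1 - u x))"
        by (simp add: algebra_simps)
      also have "\<dots> = T (\<lambda>x. \<phi> x * u x) + T (\<lambda>x. \<phi> x * (1 - u x))"
        by (intro add test_functionsI[of _ "a-e" "c+e"] sm) (use z in auto)
      also have "T (\<lambda>x. \<phi> x * u x) = 0"
        by (rule e2[OF sm(1)]) (use epos z u in \<open>force simp: not_le\<close>)
      also have "T (\<lambda>x. \<phi> x * (1 - u x)) = 0"
        by (rule e1[OF sm(2)]) (use epos z u in \<open>force simp: not_le\<close>)
      finally show "T \<phi> = 0" by simp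
    qed
  next
    case (local x)
    then have "x \<notin> supp_distr T" using disj by auto
    then obtain U where U: "open U" "x \<in> U" "\<And>\<phi>. \<phi> \<in> test_functions U \<Longrightarrow> T \<phi> = 0"
      by (auto simp: supp_distr_def)
    then obtain r where r: "r > 0" "ball x r \<subseteq> U"
      using openE by blast
    show ?case
    \<comment> \<open>An interval around \<open>x\<close> shorter than \<open>r/2\<close>, widened
      by \<open>r/4\<close> on each side, stays inside the ball of radius \<open>r\<close>.\<close>
    proof (intro exI[of _ "r/2"] conjI allI impI)
      fix a b assume ab: "a \<le> x \<and> x \<le> b \<and> b - a < r/2"
      have "{a - r/4..b + r/4} \<subseteq> U"
        using r ab by (intro order_trans[OF _ r(2)]) (auto simp: dist_real_def abs_if)
      then show "P a b" unfolding P_def using r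
        by (intro exI[of _ "r/4"]) (auto intro!: U(3) test_functionsI)
    qed (use r in auto)
  qed
  then obtain e where e: "e > 0"
    "\<And>\<phi>. smooth \<phi> \<Longrightarrow> (\<And>x. x \<notin> {a-e..b+e} \<Longrightarrow> \<phi> x = 0) \<Longrightarrow> T \<phi> = 0"
    unfolding P_def by metis
  show ?thesis
    by (rule e(2)[OF \<phi>(1)]) (use e(1) \<phi>(2) in auto)
qed

section \<open>Fourier transforms of test functions\<close>

lemma integrable_compact_support:
  fixes g :: "real \<Rightarrow> complex"
  assumes "continuous_on UNIV g" "\<And>x. x \<notin> {a..b} \<Longrightarrow> g x = 0"
  shows "integrable lborel g"
proof -
  have "set_integrable lborel {a..b} g"
    unfolding set_integrable_def
    by (intro borel_integrable_compact compact_Icc continuous_on_subset[OF assms(1)]) auto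
  moreover have "(\<lambda>x. indicator {a..b} x *\<^sub>R g x) = g"
    using assms(2) by (auto simp: indicator_def fun_eq_iff)
  ultimately show ?thesis by (simp add: set_integrable_def)
qed

lemma integral_derivative_compact_support:
  fixes g g' :: "real \<Rightarrow> complex"
  assumes "continuous_on UNIV g'" and der: "\<And>x. (g has_vector_derivative g' x) (at x)"
    and z: "\<And>x. x \<notin> {a..b} \<Longrightarrow> g x = 0" "\<And>x. x \<notin> {a..b} \<Longrightarrow> g' x = 0"
  shows "(\<integral>x. g' x \<partial>lborel) = 0"
proof -
  \<comment> \<open>The minimum and maximum cover an empty \<open>{a..b}\<close>; the shift by 1
    puts both endpoints outside it, where \<open>g\<close> vanishes.\<close>
  define A B where "A = min a b - 1" and "B = max a b + 1"
  have "A \<le> B" by (auto simp: A_def B_def)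
  have "integrable lborel g'"
    by (rule integrable_compact_support[OF assms(1) z(2)])
  then have "(\<integral>x. g' x \<partial>lborel) = integral UNIV g'"
    by (rule integral_lborel[symmetric])
  also have "(g' has_integral (g B - g A)) {A..B}"
    by (rule fundamental_theorem_of_calculus[OF \<open>A \<le> B\<close>])
      (rule has_vector_derivative_at_within[OF der])
  then have "(g' has_integral (g B - g A)) UNIV"
    by (rule has_integral_on_superset) (rule z(2), auto simp: A_def B_def)
  then have "integral UNIV g' = g B - g A"
    by (rule integral_unique)
  also have "g B = 0" by (rule z(1)) (auto simp: B_def)
  also have "g A = 0" by (rule z(1)) (auto simp: A_def)
  finally show ?thesis by simp
qed

lemma smooth_char: "smooth (\<lambda>x. exp (- (\<i> * complex_of_real (x * \<xi>))))"
  using smooth_exp_linear[of "- (\<i> * of_real \<xi>)"] by (simp add: mult_ac)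

lemma integrable_fourier_integrand:
  assumes "smooth \<phi>" "support_on UNIV \<phi> \<subseteq> {a..b}"
  shows "integrable lborel (\<lambda>x. \<phi> x * exp (- (\<i> * complex_of_real (x * \<xi>))))"
proof (rule integrable_compact_support)
  show "continuous_on UNIV (\<lambda>x. \<phi> x * exp (- (\<i> * complex_of_real (x * \<xi>))))"
    by (intro smooth_continuous_on smooth_mult smooth_char assms)
qed (use assms(2) in \<open>auto simp: support_on_def\<close>)

lemma fourier_add:
  assumes "\<phi> \<in> test_functions UNIV" "\<psi> \<in> test_functions UNIV"
  shows "fourier (\<lambda>x. \<phi> x + \<psi> x) \<xi> = fourier \<phi> \<xi> + fourier \<psi> \<xi>"
proof -
  have "integrable lborel (\<lambda>x. \<phi> x * exp (- (\<i> * complex_of_real (x * \<xi>))))"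
    if test: "\<phi> \<in> test_functions UNIV" for \<phi>
  proof -
    obtain a b where "smooth \<phi>" "support_on UNIV \<phi> \<subseteq> {a..b}"
      using test_functions_support[OF test] .
    then show ?thesis by (rule integrable_fourier_integrand)
  qed
  from Bochner_Integration.integral_add[OF this[OF assms(1)] this[OF assms(2)]]
  show ?thesis by (simp add: fourier_def distrib_left distrib_right)
qed

text \<open>The complement of \<open>{a..b}\<close> is open, so \<open>\<phi>\<close> vanishes in a
  neighbourhood of each of its points.\<close>

lemma support_on_vector_derivative:
  fixes \<phi> :: "real \<Rightarrow> 'a::real_normed_vector"
  assumes "support_on UNIV \<phi> \<subseteq> {a..b}"
  shows "support_on UNIV (\<lambda>x. vector_derivative \<phi> (at x)) \<subseteq> {a..b}"
proof -
  have "(\<phi> has_vector_derivative 0) (at x)" if "x \<notin> {a..b}" for x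
  proof (rule has_vector_derivative_transform_within_open)
    show "((\<lambda>_. 0) has_vector_derivative 0) (at x)" by simp
    show "x \<in> - {a..b}" using that by simp
    show "0 = \<phi> y" if "y \<in> - {a..b}" for y
      using that assms by (auto simp: support_on_def)
  qed auto
  then show ?thesis
    by (force simp: support_on_def dest: vector_derivative_at)
qed

text \<open>Integration by parts without boundary terms: the derivative of \<open>\<phi>\<close>
  times the character has compact support and integrates to 0.\<close>

lemma fourier_vector_derivative:
  assumes \<phi>: "smooth \<phi>" "support_on UNIV \<phi> \<subseteq> {a..b}"
  shows "fourier (\<lambda>x. vector_derivative \<phi> (at x)) \<xi> = \<i> * of_real \<xi> * fourier \<phi> \<xi>"
proof -
  define e where "e x = exp (- (\<i> * complex_of_real (x * \<xi>)))" for x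
  define \<phi>' where "\<phi>' x = vector_derivative \<phi> (at x)" for x
  note z = support_on_vector_derivative[OF \<phi>(2), folded \<phi>'_def]
  have \<phi>': "smooth \<phi>'"
    using smooth_vector_derivative[OF \<phi>(1)] by (simp add: \<phi>'_def[abs_def])
  have e: "smooth e" using smooth_char[of \<xi>] by (simp add: e_def[abs_def])
  have de: "(e has_vector_derivative - (\<i> * \<xi>) * e x) (at x)" for x
  proof -
    have e_alt: "e = (\<lambda>x. exp (- (\<i> * \<xi>) * complex_of_real x))"
      by (simp add: e_def fun_eq_iff mult_ac)
    show ?thesis unfolding e_alt
      by (rule has_vector_derivative_eq_rhs, rule has_vector_derivative_real_field)
        (auto intro!: derivative_eq_intros)
  qed
  have d: "((\<lambda>x. \<phi> x * e x) has_vector_derivative \<phi> x * (- (\<i> * \<xi>) * e x) + \<phi>' x * e x) (at x)" for x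
    unfolding \<phi>'_def by (rule has_vector_derivative_mult[OF smooth_has_vector_derivative[OF \<phi>(1)] de])
  have "(\<integral>x. \<phi> x * (- (\<i> * \<xi>) * e x) + \<phi>' x * e x \<partial>lborel) = 0"
  proof (rule integral_derivative_compact_support[OF _ d])
    show "continuous_on UNIV (\<lambda>x. \<phi> x * (- (\<i> * \<xi>) * e x) + \<phi>' x * e x)"
      by (intro smooth_continuous_on smooth_add smooth_mult smooth_const \<phi>(1) \<phi>' e)
  qed (use \<phi>(2) z in \<open>force simp: support_on_def\<close>)+
  also have "(\<integral>x. \<phi> x * (- (\<i> * \<xi>) * e x) + \<phi>' x * e x \<partial>lborel)
      = (\<integral>x. (- (\<i> * \<xi>)) * (\<phi> x * e x) \<partial>lborel) + (\<integral>x. \<phi>' x * e x \<partial>lborel)"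
    using integrable_fourier_integrand[OF \<phi>, of \<xi>, folded e_def]
      integrable_fourier_integrand[OF \<phi>' z, of \<xi>, folded e_def]
    by (subst Bochner_Integration.integral_add[symmetric])
       (auto simp: mult_ac intro!: integrable_mult_right)
  finally have "(\<integral>x. \<phi>' x * e x \<partial>lborel) = \<i> * \<xi> * (\<integral>x. \<phi> x * e x \<partial>lborel)"
    by (simp add: algebra_simps)
  then show ?thesis
    unfolding fourier_def e_def[symmetric] \<phi>'_def[symmetric] by (simp add: mult_ac)
qed

lemma norm_fourier_le:
  "norm (fourier \<phi> \<xi>) \<le> (\<integral>x. norm (\<phi> x) \<partial>lborel) / sqrt (2 * pi)"
proof -
  have "norm (\<integral>x. \<phi> x * exp (- (\<i> * complex_of_real (x * \<xi>))) \<partial>lborel) \<le>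
      (\<integral>x. norm (\<phi> x * exp (- (\<i> * complex_of_real (x * \<xi>)))) \<partial>lborel)"
    by (rule integral_norm_bound)
  also have "\<dots> = (\<integral>x. norm (\<phi> x) \<partial>lborel)"
    by (simp add: norm_mult)
  finally show ?thesis
    by (simp add: fourier_def norm_mult divide_inverse norm_inverse norm_divide mult.commute)
qed

text \<open>The transform of the second derivative is \<open>- \<xi>\<^sup>2\<close> times that of
  \<open>\<phi>\<close>. Both transforms are bounded by L_1 norms, and adding the two bounds gives
  the denominator \<open>1 + \<xi>\<^sup>2\<close>.\<close>

lemma fourier_decay:
  assumes \<phi>: "smooth \<phi>" "support_on UNIV \<phi> \<subseteq> {a..b}"
  obtains C where "C > 0" "\<And>\<xi>. norm (fourier \<phi> \<xi>) \<le> C / (1 + \<xi>\<^sup>2)"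
proof -
  define \<phi>1 where "\<phi>1 x = vector_derivative \<phi> (at x)" for x
  define \<phi>2 where "\<phi>2 x = vector_derivative \<phi>1 (at x)" for x
  have 1: "smooth \<phi>1" "support_on UNIV \<phi>1 \<subseteq> {a..b}"
    using smooth_vector_derivative[OF \<phi>(1)] support_on_vector_derivative[OF \<phi>(2)]
    by (simp_all add: \<phi>1_def[abs_def])
  define I where "I \<psi> = (\<integral>x. norm (\<psi> x) \<partial>lborel) / sqrt (2 * pi)" for \<psi> :: "real \<Rightarrow> complex"
  \<comment> \<open>The summand 1 only keeps the constant positive when \<open>\<phi>\<close> is
    zero.\<close>
  have "norm (fourier \<phi> \<xi>) \<le> (I \<phi> + I \<phi>2 + 1) / (1 + \<xi>\<^sup>2)" for \<xi>
  proof -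
    have "fourier \<phi>2 \<xi> = \<i> * of_real \<xi> * (\<i> * of_real \<xi> * fourier \<phi> \<xi>)"
      using fourier_vector_derivative[OF 1, of \<xi>] fourier_vector_derivative[OF \<phi>, of \<xi>]
      by (simp add: \<phi>1_def[abs_def] \<phi>2_def[abs_def])
    then have "\<xi>\<^sup>2 * norm (fourier \<phi> \<xi>) = norm (fourier \<phi>2 \<xi>)"
      by (simp add: norm_mult power2_eq_square)
    also have "\<dots> \<le> I \<phi>2" unfolding I_def by (rule norm_fourier_le)
    finally have "\<xi>\<^sup>2 * norm (fourier \<phi> \<xi>) \<le> I \<phi>2" .
    moreover have "norm (fourier \<phi> \<xi>) \<le> I \<phi>" unfolding I_def by (rule norm_fourier_le)
    ultimately have "norm (fourier \<phi> \<xi>) * (1 + \<xi>\<^sup>2) \<le> I \<phi> + I \<phi>2 + 1"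
      by (simp add: algebra_simps)
    then show ?thesis by (subst pos_le_divide_eq) (auto simp: add_pos_nonneg)
  qed
  moreover have "I \<phi> + I \<phi>2 + 1 > 0"
    by (auto simp: I_def intro!: add_nonneg_pos)
  ultimately show ?thesis using that by blast
qed

lemma fourier_measurable [measurable]:
  assumes [measurable]: "\<phi> \<in> borel_measurable borel"
  shows "fourier \<phi> \<in> borel_measurable borel"
proof -
  have "(\<lambda>\<xi>. \<integral>x. \<phi> x * exp (- (\<i> * complex_of_real (x * \<xi>))) \<partial>lborel) \<in> borel_measurable borel"
    by (rule lborel.borel_measurable_lebesgue_integral) simp
  then show ?thesis
    unfolding fourier_def[abs_def] by measurable
qed

section \<open>Approximate identities on \<open>L_p\<close>\<close>

lemma
  shows integrable_inverse_1_plus_square_lborel: "integrable lborel (\<lambda>x::real. 1 / (1 + x\<^sup>2))"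
    and integral_inverse_1_plus_square_lborel: "(\<integral>x. 1 / (1 + (x::real)\<^sup>2) \<partial>lborel) = pi"
  using integrable_inverse_1_plus_square LBINT_inverse_1_plus_square
  by (simp_all add: set_integrable_def interval_lebesgue_integral_def set_lebesgue_integral_def divide_inverse)

lemma
  shows integrable_inverse_1_plus_square_shifted:
    "integrable lborel (\<lambda>x::real. 1 / (1 + (x - x0)\<^sup>2))"
    and integral_inverse_1_plus_square_shifted:
    "(\<integral>x. 1 / (1 + (x - x0)\<^sup>2) \<partial>lborel) = pi"
  using lborel_integrable_real_affine[OF integrable_inverse_1_plus_square_lborel, of 1 "-x0"]
    lborel_integral_real_affine[of 1 "\<lambda>x::real. 1 / (1 + x\<^sup>2)" "-x0"]
    integral_inverse_1_plus_square_lborel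
  by simp_all

text \<open>The pointwise bound \<open>|z| \<le> t (1 + |z/t|\<^sup>p)\<close> takes the place of Hoelder's inequality;
  the scale \<open>t\<close> is later taken to be the norm of \<open>f\<close>.\<close>

lemma norm_le_scaled_powr:
  assumes "p \<ge> 1" "t > 0"
  shows "norm z \<le> t * (1 + norm z powr p / t powr p)"
proof (cases "norm z \<le> t")
  case True
  then show ?thesis using assms by (simp add: distrib_left add_increasing2)
next
  case False
  then have "1 \<le> norm z / t" using assms by simp
  then have "norm z / t \<le> (norm z / t) powr p"
    using powr_mono[of 1 p "norm z / t"] assms by simp
  also have "\<dots> = norm z powr p / t powr p"
    using assms by (simp add: powr_divide)
  also have "\<dots> \<le> 1 + norm z powr p / t powr p" by simp
  finally show ?thesis using assms by (simp add: pos_divide_le_eq mult.commute)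
qed

text \<open>The bound of \<open>norm_le_scaled_powr\<close> is integrated against the kernel. Its
  constant part gives \<open>pi\<close>; in the other part the weight
  \<open>1 / (1 + (x - x0)\<^sup>2)\<close> is estimated by 1, so that the plain integral of
  \<open>norm (f x) powr p\<close> remains.\<close>

lemma Lp_times_decaying:
  fixes f K :: "real \<Rightarrow> complex"
  assumes [measurable]: "f \<in> borel_measurable borel" "K \<in> borel_measurable borel"
    and p: "p \<ge> 1" and f: "integrable lborel (\<lambda>x. norm (f x) powr p)"
    and K: "\<And>x. norm (K x) \<le> C / (1 + (x - x0)\<^sup>2)" and "C \<ge> 0" "t > 0"
  shows "integrable lborel (\<lambda>x. f x * K x)"
    and "norm (\<integral>x. f x * K x \<partial>lborel) \<le> C * t * (pi + (\<integral>x. norm (f x) powr p \<partial>lborel) / t powr p)"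
proof -
  define G where "G x = C * t * (1 / (1 + (x - x0)\<^sup>2) + norm (f x) powr p / t powr p)" for x
  have G: "integrable lborel G"
    unfolding G_def
    by (intro integrable_mult_right Bochner_Integration.integrable_add integrable_inverse_1_plus_square_shifted
        integrable_divide f)
  have le: "norm (f x * K x) \<le> G x" for x
  proof -
    have q: "0 \<le> norm (f x) powr p / t powr p" by simp
    have pos: "1 + (x - x0)\<^sup>2 \<ge> 1" by simp
    have "norm (f x * K x) \<le> (t * (1 + norm (f x) powr p / t powr p)) * (C / (1 + (x - x0)\<^sup>2))"
      unfolding norm_mult
      by (intro mult_mono K norm_le_scaled_powr p) (use \<open>t > 0\<close> in auto)
    also have "\<dots> = C * t * (1 / (1 + (x - x0)\<^sup>2) + (norm (f x) powr p / t powr p) / (1 + (x - x0)\<^sup>2))"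
      by (simp add: add_divide_distrib distrib_left distrib_right mult_ac)
    also have "\<dots> \<le> G x"
      unfolding G_def
    proof (intro mult_left_mono add_left_mono)
      show "(norm (f x) powr p / t powr p) / (1 + (x - x0)\<^sup>2) \<le> norm (f x) powr p / t powr p"
        using divide_left_mono[OF pos q] pos by simp
    qed (use \<open>C \<ge> 0\<close> \<open>t > 0\<close> in auto)
    finally show ?thesis .
  qed
  show int: "integrable lborel (\<lambda>x. f x * K x)"
    by (rule Bochner_Integration.integrable_bound[OF G]) (auto intro!: AE_I2 order_trans[OF le abs_ge_self])
  have "norm (\<integral>x. f x * K x \<partial>lborel) \<le> (\<integral>x. norm (f x * K x) \<partial>lborel)"
    by (rule integral_norm_bound)
  also have "\<dots> \<le> (\<integral>x. G x \<partial>lborel)"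
    by (intro integral_mono integrable_norm int G le)
  also have "\<dots> = C * t * (pi + (\<integral>x. norm (f x) powr p \<partial>lborel) / t powr p)"
    unfolding G_def
    by (subst integral_mult_right_zero, subst Bochner_Integration.integral_add)
      (use integrable_inverse_1_plus_square_shifted integral_inverse_1_plus_square_shifted f in auto)
  finally show "norm (\<integral>x. f x * K x \<partial>lborel) \<le> \<dots>" .
qed

text \<open>Since \<open>f\<close> may be unbounded, dominated convergence is applied only within
  distance 1 of \<open>x0\<close>, where continuity bounds \<open>f\<close>. Farther away the
  rescaled kernel is O(1/n) times \<open>1 / (1 + (x - x0)\<^sup>2)\<close>, and
  \<open>Lp_times_decaying\<close> sends that part to 0.\<close>

lemma approximate_identity:
  fixes f K :: "real \<Rightarrow> complex"
  assumes cont: "continuous_on UNIV f" and [measurable]: "K \<in> borel_measurable borel"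
    and p: "p \<ge> 1" and f: "integrable lborel (\<lambda>x. norm (f x) powr p)"
    and K: "\<And>x. norm (K x) \<le> C / (1 + x\<^sup>2)" and C: "C \<ge> 0"
  shows "(\<lambda>n. \<integral>x. f x * (of_nat (Suc n) * K (real (Suc n) * (x - x0))) \<partial>lborel)
      \<longlonglongrightarrow> f x0 * (\<integral>x. K x \<partial>lborel)"
proof -
  have [measurable]: "f \<in> borel_measurable borel"
    using cont by (rule borel_measurable_continuous_onI)
  define B where "B = {x0 - 1..x0 + 1}"
  have [measurable]: "B \<in> sets borel" by (simp add: B_def)
  define k where "k n x = of_nat (Suc n) * K (real (Suc n) * (x - x0))" for n x
  define near far where "near n x = f x * (indicator B x * k n x)"
    and "far n x = f x * (indicator (- B) x * k n x)" for n x
  have [measurable]: "k n \<in> borel_measurable borel" for n unfolding k_def by measurable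
  have kn: "norm (k n x) \<le> Suc n * C / (1 + (x - x0)\<^sup>2)" for n x
  proof -
    have "norm (k n x) \<le> Suc n * (C / (1 + (Suc n * (x - x0))\<^sup>2))"
      unfolding k_def norm_mult using K[of "Suc n * (x - x0)"] by (intro mult_mono) (auto simp del: of_nat_Suc)
    also have "\<dots> \<le> Suc n * (C / (1 + (x - x0)\<^sup>2))"
    proof (intro mult_left_mono divide_left_mono)
      have "1 * (x - x0)\<^sup>2 \<le> (real (Suc n))\<^sup>2 * (x - x0)\<^sup>2"
        by (intro mult_right_mono one_le_power) auto
      then show "1 + (x - x0)\<^sup>2 \<le> 1 + (Suc n * (x - x0))\<^sup>2"
        by (simp add: power_mult_distrib)
    qed (use C in \<open>auto intro!: mult_pos_pos add_pos_nonneg\<close>)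
    finally show ?thesis by simp
  qed
  \<comment> \<open>With \<open>d = x - x0\<close>, \<open>\<bar>d\<bar> \<ge> 1\<close> and
    \<open>m = Suc n\<close> one has
    \<open>1 + m\<^sup>2 d\<^sup>2 \<ge> m\<^sup>2 (1 + d\<^sup>2) / 2\<close>; one factor
    \<open>m\<close> of the gain survives the factor \<open>m\<close> in front of the
    kernel.\<close>
  have kfar: "norm (indicator (- B) x * k n x) \<le> (2 * C / Suc n) / (1 + (x - x0)\<^sup>2)" for n x
  proof (cases "x \<in> B")
    case False
    then have "1 \<le> \<bar>x - x0\<bar>" by (auto simp: B_def)
    then have u: "1 \<le> (x - x0)\<^sup>2" by (simp add: abs_le_square_iff[of 1, simplified])
    then have pos: "0 < 1 + (x - x0)\<^sup>2" by simp
    have scale: "m * (C / (m\<^sup>2 * (v / 2))) = (2 * C / m) / v" if "m > 0" "v > 0" for m v :: real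
      using that by (simp add: field_simps power2_eq_square)
    have "norm (k n x) \<le> Suc n * (C / (1 + (Suc n * (x - x0))\<^sup>2))"
      unfolding k_def norm_mult using K[of "Suc n * (x - x0)"] by (intro mult_mono) (auto simp del: of_nat_Suc)
    also have "\<dots> \<le> Suc n * (C / ((real (Suc n))\<^sup>2 * ((1 + (x - x0)\<^sup>2) / 2)))"
    proof (intro mult_left_mono divide_left_mono)
      have "(real (Suc n))\<^sup>2 * ((1 + (x - x0)\<^sup>2) / 2) \<le> (real (Suc n))\<^sup>2 * (x - x0)\<^sup>2"
        using u by (intro mult_left_mono) auto
      then show "(real (Suc n))\<^sup>2 * ((1 + (x - x0)\<^sup>2) / 2) \<le> 1 + (Suc n * (x - x0))\<^sup>2"
        unfolding power_mult_distrib by linarith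
    next
      have "(real (Suc n))\<^sup>2 * ((1 + (x - x0)\<^sup>2) / 2) > 0"
        using pos by (intro mult_pos_pos) auto
      then show "0 < (1 + (Suc n * (x - x0))\<^sup>2) * ((real (Suc n))\<^sup>2 * ((1 + (x - x0)\<^sup>2) / 2))"
        by (intro mult_pos_pos[of "1 + _"] add_pos_nonneg) auto
    qed (use C in auto)
    also have "\<dots> = (2 * C / Suc n) / (1 + (x - x0)\<^sup>2)"
      by (rule scale) (use pos in auto)
    finally show ?thesis using False by simp
  qed (use C in auto)
  have knear: "norm (indicator B x * k n x) \<le> Suc n * C / (1 + (x - x0)\<^sup>2)" for n x
    using kn[where x=x and n=n] C by (cases "x \<in> B") auto
  have int_near: "integrable lborel (near n)" for n
    unfolding near_def
    by (rule Lp_times_decaying(1)[where K="\<lambda>x. indicator B x * k n x", OF _ _ p f knear, of 1])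
      (use C in auto)
  have int_far: "integrable lborel (far n)" for n
    unfolding far_def
    by (rule Lp_times_decaying(1)[where K="\<lambda>x. indicator (- B) x * k n x", OF _ _ p f kfar, of 1])
      (use C in auto)
  have "(\<lambda>n. \<integral>x. far n x \<partial>lborel) \<longlonglongrightarrow> 0"
  proof (rule Lim_null_comparison)
    let ?J = "pi + (\<integral>x. norm (f x) powr p \<partial>lborel)"
    have "norm (\<integral>x. far n x \<partial>lborel) \<le> (2 * C / Suc n) * 1 * (pi + (\<integral>x. norm (f x) powr p \<partial>lborel) / 1 powr p)" for n
      unfolding far_def
      by (rule Lp_times_decaying(2)[where K="\<lambda>x. indicator (- B) x * k n x", OF _ _ p f kfar]) (use C in auto)
    then show "\<forall>\<^sub>F n in sequentially. norm (\<integral>x. far n x \<partial>lborel) \<le> 2 * C * ?J * inverse (real (Suc n))"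
      by (intro always_eventually) (simp add: divide_inverse algebra_simps del: of_nat_Suc)
    show "(\<lambda>n. 2 * C * ?J * inverse (real (Suc n))) \<longlonglongrightarrow> 0"
      by (intro tendsto_mult_right_zero LIMSEQ_inverse_real_of_nat)
  qed
  moreover have "(\<lambda>n. \<integral>x. near n x \<partial>lborel) \<longlonglongrightarrow> f x0 * (\<integral>x. K x \<partial>lborel)"
  proof -
    have "compact (f ` B)"
      unfolding B_def by (intro compact_continuous_image continuous_on_subset[OF cont]) auto
    then obtain M where M: "\<And>x. x \<in> B \<Longrightarrow> norm (f x) \<le> M"
      by (meson bounded_iff compact_imp_bounded imageI)
    \<comment> \<open>This is the near part after the substitution
      \<open>x = x0 + y / Suc n\<close>, whose Jacobian cancels the factor \<open>Suc n\<close>; the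
      kernel no longer depends on \<open>n\<close>.\<close>
    define h where "h n y = f (x0 + y / Suc n) * indicator B (x0 + y / Suc n) * K y" for n y
    have "(\<integral>x. near n x \<partial>lborel) = (\<integral>y. h n y \<partial>lborel)" for n
    proof -
      have "(\<integral>x. near n x \<partial>lborel) = (1 / Suc n) *\<^sub>R (\<integral>y. near n (x0 + (1 / Suc n) * y) \<partial>lborel)"
        using lborel_integral_real_affine[of "1 / Suc n" "near n" x0] by simp
      also have "\<dots> = (\<integral>y. (1 / Suc n) *\<^sub>R near n (x0 + (1 / Suc n) * y) \<partial>lborel)"
        by (rule integral_scaleR_right[symmetric])
      also have "(\<lambda>y. (1 / Suc n) *\<^sub>R near n (x0 + (1 / Suc n) * y)) = h n"
        by (simp add: fun_eq_iff near_def h_def k_def scaleR_conv_of_real field_simps del: of_nat_Suc)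
      finally show ?thesis .
    qed
    moreover have "(\<lambda>n. \<integral>y. h n y \<partial>lborel) \<longlonglongrightarrow> (\<integral>y. f x0 * K y \<partial>lborel)"
    proof (rule integral_dominated_convergence)
      show "integrable lborel (\<lambda>y. M * (C * (1 / (1 + y\<^sup>2))))"
        by (intro integrable_mult_right integrable_inverse_1_plus_square_lborel)
      show "AE y in lborel. norm (h n y) \<le> M * (C * (1 / (1 + y\<^sup>2)))" for n
      proof (intro AE_I2)
        fix y
        have "0 \<le> M" using order_trans[OF norm_ge_zero M[of x0]] by (simp add: B_def)
        then have "norm (f (x0 + y / Suc n) * indicator B (x0 + y / Suc n)) \<le> M"
          using M by (auto simp: indicator_def)
        with \<open>0 \<le> M\<close> show "norm (h n y) \<le> M * (C * (1 / (1 + y\<^sup>2)))"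
          unfolding h_def norm_mult[of "_ * _" "K y"] using K[of y] by (intro mult_mono) auto
      qed
      show "AE y in lborel. (\<lambda>n. h n y) \<longlonglongrightarrow> f x0 * K y"
      proof (intro AE_I2)
        fix y
        have y: "(\<lambda>n. x0 + y / Suc n) \<longlonglongrightarrow> x0"
          using tendsto_add[OF tendsto_const tendsto_mult_right_zero[OF LIMSEQ_inverse_real_of_nat], of x0 y]
          by (simp add: divide_inverse)
        have "isCont f x0" using cont by (simp add: continuous_on_eq_continuous_at)
        then have "(\<lambda>n. f (x0 + y / Suc n)) \<longlonglongrightarrow> f x0"
          using y by (rule isCont_tendsto_compose)
        moreover have "\<forall>\<^sub>F n in sequentially. x0 + y / Suc n \<in> ball x0 1"
          by (rule topological_tendstoD[OF y]) auto
        then have "\<forall>\<^sub>F n in sequentially. 1 = (indicator B (x0 + y / Suc n) :: complex)"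
        proof eventually_elim
          case (elim n)
          moreover have "ball x0 1 \<subseteq> B" by (auto simp: B_def dist_real_def)
          ultimately have "x0 + y / Suc n \<in> B" by blast
          then show ?case by simp
        qed
        then have "(\<lambda>n. indicator B (x0 + y / Suc n)) \<longlonglongrightarrow> (1 :: complex)"
          by (rule tendsto_eventually[OF eventually_mono]) auto
        ultimately have "(\<lambda>n. f (x0 + y / Suc n) * indicator B (x0 + y / Suc n) * K y) \<longlonglongrightarrow> f x0 * 1 * K y"
          by (intro tendsto_mult tendsto_const)
        then show "(\<lambda>n. h n y) \<longlonglongrightarrow> f x0 * K y" by (simp add: h_def)
      qed
    qed (auto simp: h_def)
    ultimately show ?thesis by simp
  qed
  ultimately have "(\<lambda>n. (\<integral>x. near n x \<partial>lborel) + (\<integral>x. far n x \<partial>lborel)) \<longlonglongrightarrow> f x0 * (\<integral>x. K x \<partial>lborel)"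
    using tendsto_add by fastforce
  moreover have "(\<integral>x. near n x \<partial>lborel) + (\<integral>x. far n x \<partial>lborel) = (\<integral>x. f x * k n x \<partial>lborel)" for n
    by (subst Bochner_Integration.integral_add[symmetric, OF int_near int_far])
      (auto simp: near_def far_def intro!: Bochner_Integration.integral_cong split: split_indicator)
  ultimately show ?thesis by (simp add: k_def)
qed

section \<open>Inversion at the origin\<close>

lemma fourier_gaussian:
  "fourier (\<lambda>x. of_real (exp (- x\<^sup>2 / 2))) \<xi> = of_real (exp (- \<xi>\<^sup>2 / 2))"
proof -
  \<comment> \<open>The characteristic function has a plus sign in its exponent, hence the argument
    \<open>- \<xi>\<close>.\<close>
  have "char std_normal_distribution (- \<xi>) =
      (\<integral>x. std_normal_density x *\<^sub>R exp (\<i> * complex_of_real (- \<xi> * x)) \<partial>lborel)"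
    unfolding char_def by (rule integral_density) (auto simp: normal_density_nonneg)
  also have "\<dots> = (\<integral>x. complex_of_real (1 / sqrt (2 * pi)) *
      (of_real (exp (- x\<^sup>2 / 2)) * exp (- (\<i> * complex_of_real (x * \<xi>)))) \<partial>lborel)"
    by (simp add: std_normal_density_def scaleR_conv_of_real mult_ac)
  also have "\<dots> = fourier (\<lambda>x. of_real (exp (- x\<^sup>2 / 2))) \<xi>"
    unfolding fourier_def by (rule integral_mult_right_zero)
  finally show ?thesis
    by (simp add: char_std_normal_distribution)
qed

text \<open>Fubini's theorem: the character is symmetric in its two variables and has modulus 1, so
  the double integrand is dominated by the product of the two integrable functions.\<close>

lemma fourier_multiplication:
  fixes g \<phi> :: "real \<Rightarrow> complex"
  assumes g: "integrable lborel g" and \<phi>: "integrable lborel \<phi>"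
  shows "(\<integral>x. g x * fourier \<phi> x \<partial>lborel) = (\<integral>\<xi>. fourier g \<xi> * \<phi> \<xi> \<partial>lborel)"
proof -
  define e where "e x \<xi> = exp (- (\<i> * complex_of_real (x * \<xi>)))" for x \<xi>
  have [measurable]: "g \<in> borel_measurable borel" "\<phi> \<in> borel_measurable borel"
    using g \<phi> by auto
  have ne: "norm (e x \<xi>) = 1" for x \<xi> by (simp add: e_def)
  have meas: "(\<lambda>(x, \<xi>). g x * \<phi> \<xi> * e x \<xi>) \<in> borel_measurable (lborel \<Otimes>\<^sub>M lborel)"
    unfolding e_def by measurable
  have m1: "e x \<in> borel_measurable borel" for x unfolding e_def by measurable
  have i1: "integrable lborel (\<lambda>\<xi>. g x * \<phi> \<xi> * e x \<xi>)" for x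
    by (rule Bochner_Integration.integrable_bound[OF integrable_mult_right[OF \<phi>, of "g x"]])
      (use m1[of x] in \<open>auto simp: norm_mult ne\<close>)
  have int: "integrable (lborel \<Otimes>\<^sub>M lborel) (\<lambda>(x, \<xi>). g x * \<phi> \<xi> * e x \<xi>)"
  proof (rule lborel_pair.Fubini_integrable[OF meas])
    show "integrable lborel (\<lambda>x. \<integral>\<xi>. norm (case (x, \<xi>) of (x, \<xi>) \<Rightarrow> g x * \<phi> \<xi> * e x \<xi>) \<partial>lborel)"
      using g by (simp add: norm_mult ne)
  qed (use i1 in auto)
  define c where "c = complex_of_real (1 / sqrt (2 * pi))"
  have 1: "g x * fourier \<phi> x = c * (\<integral>\<xi>. g x * \<phi> \<xi> * e x \<xi> \<partial>lborel)" for x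
  proof -
    have "fourier \<phi> x = c * (\<integral>\<xi>. \<phi> \<xi> * e x \<xi> \<partial>lborel)"
      by (simp only: fourier_def e_def c_def mult.commute[of x])
    moreover have "(\<integral>\<xi>. g x * \<phi> \<xi> * e x \<xi> \<partial>lborel) = g x * (\<integral>\<xi>. \<phi> \<xi> * e x \<xi> \<partial>lborel)"
      by (simp only: mult.assoc integral_mult_right_zero)
    ultimately show ?thesis by (simp only: mult.left_commute)
  qed
  have 2: "fourier g \<xi> * \<phi> \<xi> = c * (\<integral>x. g x * \<phi> \<xi> * e x \<xi> \<partial>lborel)" for \<xi>
  proof -
    have "(\<integral>x. g x * \<phi> \<xi> * e x \<xi> \<partial>lborel) = (\<integral>x. g x * e x \<xi> * \<phi> \<xi> \<partial>lborel)"
      by (simp only: mult_ac)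
    also have "\<dots> = (\<integral>x. g x * e x \<xi> \<partial>lborel) * \<phi> \<xi>"
      by (rule integral_mult_left_zero)
    finally show ?thesis by (simp add: fourier_def e_def c_def)
  qed
  show ?thesis
    unfolding 1 2 using lborel_pair.Fubini_integral[OF int] by simp
qed

text \<open>Dilating by \<open>m\<close> concentrates the transform at scale \<open>1/m\<close>, and
  the modulation moves its centre to \<open>x0\<close>. This turns an approximate identity into
  transforms of test functions.\<close>

lemma fourier_dilate_modulate:
  fixes \<phi> :: "real \<Rightarrow> complex" and m x0 :: real
  assumes "m > 0"
  shows "fourier (\<lambda>\<xi>. \<phi> (\<xi> / m) * exp (\<i> * x0 * complex_of_real \<xi>)) x = m * fourier \<phi> (m * (x - x0))"
proof -
  define h where "h \<xi> = \<phi> (\<xi> / m) * exp (\<i> * x0 * complex_of_real \<xi>) * exp (- (\<i> * complex_of_real (\<xi> * x)))" for \<xi>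
  have "(\<integral>\<xi>. h \<xi> \<partial>lborel) = m *\<^sub>R (\<integral>\<xi>. h (0 + m * \<xi>) \<partial>lborel)"
    using lborel_integral_real_affine[of m h 0] assms by simp
  also have "(\<lambda>\<xi>. h (0 + m * \<xi>)) = (\<lambda>\<xi>. \<phi> \<xi> * exp (- (\<i> * complex_of_real (\<xi> * (m * (x - x0))))))"
    using assms by (simp add: fun_eq_iff h_def mult.assoc exp_add[symmetric] algebra_simps)
  finally show ?thesis
    by (simp add: fourier_def h_def scaleR_conv_of_real)
qed

lemma integrable_gaussian: "integrable lborel (\<lambda>x. complex_of_real (exp (- x\<^sup>2 / 2)))"
proof -
  have "(\<lambda>x. complex_of_real (exp (- x\<^sup>2 / 2))) = (\<lambda>x. of_real (sqrt (2 * pi) * std_normal_density x))"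
    by (simp add: std_normal_density_def fun_eq_iff)
  then show ?thesis by simp
qed

lemma integral_gaussian: "(\<integral>x. complex_of_real (exp (- x\<^sup>2 / 2)) \<partial>lborel) = sqrt (2 * pi)"
proof -
  have "complex_of_real (1 / sqrt (2 * pi)) * (\<integral>x. complex_of_real (exp (- x\<^sup>2 / 2)) \<partial>lborel) = 1"
    using fourier_gaussian[of 0] by (simp add: fourier_def)
  then show ?thesis by (simp add: field_simps)
qed

text \<open>Fourier inversion at the origin: the multiplication formula is applied to a Gaussian and to
  dilates of \<open>\<phi>\<close> whose transforms concentrate at the origin.\<close>

lemma integral_fourier:
  fixes \<phi> :: "real \<Rightarrow> complex"
  assumes \<phi>: "smooth \<phi>" "support_on UNIV \<phi> \<subseteq> {a..b}"
  shows "(\<integral>x. fourier \<phi> x \<partial>lborel) = sqrt (2 * pi) * \<phi> 0"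
proof -
  define G where "G x = complex_of_real (exp (- x\<^sup>2 / 2))" for x
  have G: "integrable lborel G"
    using integrable_gaussian by (simp add: G_def[abs_def])
  have [measurable]: "\<phi> \<in> borel_measurable borel" by (rule smooth_measurable[OF \<phi>(1)])
  obtain C where C: "C > 0" "\<And>\<xi>. norm (fourier \<phi> \<xi>) \<le> C / (1 + \<xi>\<^sup>2)"
    using fourier_decay[OF \<phi>] by blast
  have "(\<lambda>n. \<integral>x. G x * (of_nat (Suc n) * fourier \<phi> (real (Suc n) * (x - 0))) \<partial>lborel)
      \<longlonglongrightarrow> G 0 * (\<integral>x. fourier \<phi> x \<partial>lborel)"
  proof (rule approximate_identity[where p = 1])
    show "continuous_on UNIV G" unfolding G_def by (intro continuous_intros) auto
    show "integrable lborel (\<lambda>x. norm (G x) powr 1)"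
      using integrable_norm[OF G] by simp
  qed (use C in auto)
  moreover have "(\<integral>x. G x * (of_nat (Suc n) * fourier \<phi> (real (Suc n) * (x - 0))) \<partial>lborel)
      = (\<integral>\<xi>. G \<xi> * \<phi> (\<xi> / Suc n) \<partial>lborel)" for n
  proof -
    have sm: "smooth (\<lambda>\<xi>. \<phi> (\<xi> / Suc n))"
      using smooth_affine[OF \<phi>(1), of "1 / Suc n" 0] by simp
    have int: "integrable lborel (\<lambda>\<xi>. \<phi> (\<xi> / Suc n))"
      by (rule integrable_compact_support[OF smooth_continuous_on[OF sm], of "a * Suc n" "b * Suc n"])
        (use \<phi>(2) in \<open>auto simp: support_on_def field_simps simp del: of_nat_Suc\<close>)
    have "of_nat (Suc n) * fourier \<phi> (real (Suc n) * (x - 0)) = fourier (\<lambda>\<xi>. \<phi> (\<xi> / Suc n)) x" for x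
      using fourier_dilate_modulate[of "real (Suc n)" \<phi> 0 x] by simp
    \<comment> \<open>The Gaussian is its own transform, so the multiplication formula leaves the
      same weight \<open>G\<close> on both sides.\<close>
    moreover have "fourier G = G"
      using fourier_gaussian by (simp add: G_def[abs_def] fun_eq_iff)
    ultimately show ?thesis
      using fourier_multiplication[OF G int] by simp
  qed
  \<comment> \<open>The second evaluation of the same limit: the stretched \<open>\<phi>\<close>
    tends boundedly to the constant \<open>\<phi> 0\<close>.\<close>
  moreover have "(\<lambda>n. \<integral>\<xi>. G \<xi> * \<phi> (\<xi> / Suc n) \<partial>lborel) \<longlonglongrightarrow> (\<integral>\<xi>. G \<xi> * \<phi> 0 \<partial>lborel)"
  proof -
    have "compact (\<phi> ` {a..b})"
      by (intro compact_continuous_image smooth_continuous_on \<phi>(1)) auto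
    then obtain M where M: "\<And>x. x \<in> {a..b} \<Longrightarrow> norm (\<phi> x) \<le> M"
      by (meson bounded_iff compact_imp_bounded imageI)
    have bd: "norm (\<phi> x) \<le> \<bar>M\<bar>" for x
      using M[of x] \<phi>(2) by (cases "\<phi> x = 0") (auto simp: support_on_def intro: order_trans[OF _ abs_ge_self])
    show ?thesis
    proof (rule integral_dominated_convergence)
      show "integrable lborel (\<lambda>x. norm (G x) * \<bar>M\<bar>)"
        by (intro integrable_mult_left integrable_norm G)
      show "AE x in lborel. norm (G x * \<phi> (x / Suc n)) \<le> norm (G x) * \<bar>M\<bar>" for n
        by (intro AE_I2) (simp add: norm_mult mult_left_mono bd)
      show "AE x in lborel. (\<lambda>n. G x * \<phi> (x / Suc n)) \<longlonglongrightarrow> G x * \<phi> 0"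
      proof (intro AE_I2 tendsto_mult tendsto_const)
        fix x
        have "(\<lambda>n. x / Suc n) \<longlonglongrightarrow> 0"
          using tendsto_mult_right_zero[OF LIMSEQ_inverse_real_of_nat, of x] by (simp add: divide_inverse)
        moreover have "isCont \<phi> 0"
          using smooth_continuous_on[OF \<phi>(1), of UNIV] by (simp add: continuous_on_eq_continuous_at)
        ultimately show "(\<lambda>n. \<phi> (x / Suc n)) \<longlonglongrightarrow> \<phi> 0"
          by (rule isCont_tendsto_compose[rotated])
      qed
    qed (use G in \<open>auto simp: G_def\<close>)
  qed
  ultimately have "G 0 * (\<integral>x. fourier \<phi> x \<partial>lborel) = (\<integral>\<xi>. G \<xi> * \<phi> 0 \<partial>lborel)"
    using LIMSEQ_unique by simp
  then show ?thesis
    using integral_gaussian by (simp add: G_def)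
qed

section \<open>Bernstein spaces\<close>

text \<open>Needed for additivity of the distribution on test functions: the Bochner integral is
  additive only on integrable functions.\<close>

lemma Lp_times_fourier_integrable:
  fixes f :: "real \<Rightarrow> complex"
  assumes "f \<in> borel_measurable borel" "p \<ge> 1" "integrable lborel (\<lambda>x. norm (f x) powr p)"
    and "\<phi> \<in> test_functions UNIV"
  shows "integrable lborel (\<lambda>x. f x * fourier \<phi> x)"
proof -
  obtain a b where \<phi>: "smooth \<phi>" "support_on UNIV \<phi> \<subseteq> {a..b}"
    using test_functions_support[OF assms(4)] .
  obtain C where C: "C > 0" "\<And>\<xi>. norm (fourier \<phi> \<xi>) \<le> C / (1 + \<xi>\<^sup>2)"
    using fourier_decay[OF \<phi>] by blast
  show ?thesis
    by (rule Lp_times_decaying(1)[OF assms(1) fourier_measurable[OF smooth_measurable[OF \<phi>(1)]] assms(2,3), of C 0 1])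
      (use C in auto)
qed

text \<open>The test functions \<open>\<eta> (\<xi> / m) exp (i x0 \<xi>)\<close> have transforms concentrating at \<open>x0\<close>. Multiplying them
  by \<open>\<eta>\<close> changes them only off \<open>{-\<sigma>..\<sigma>}\<close>, and the product no longer depends on \<open>m\<close> once \<open>m\<close> is large.\<close>

lemma reproducing_formula:
  fixes f :: "real \<Rightarrow> complex"
  assumes cont: "continuous_on UNIV f" and p: "p \<ge> 1" and f: "integrable lborel (\<lambda>x. norm (f x) powr p)"
    and supp: "supp_distr (fourier_distr (function_distr f)) \<subseteq> {-\<sigma>..\<sigma>}"
    and \<sigma>: "0 < \<sigma>" "\<sigma> < r" "r < R"
    and u: "smooth u" "\<And>x. x \<le> r \<Longrightarrow> u x = 0" "\<And>x. x \<ge> R \<Longrightarrow> u x = 1"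
    and \<eta>_def: "\<eta> = (\<lambda>x. 1 - (u x + u (- x)))"
  shows "sqrt (2 * pi) * f x0 = (\<integral>x. f x * fourier \<eta> (x - x0) \<partial>lborel)"
proof -
  have [measurable]: "f \<in> borel_measurable borel"
    using cont by (rule borel_measurable_continuous_onI)
  have um: "smooth (\<lambda>x. u (- x))"
    using smooth_affine[OF u(1), of "-1" 0] by simp
  have \<eta>: "smooth \<eta>" unfolding \<eta>_def
    by (intro smooth_diff smooth_add smooth_const u(1) um)
  have \<eta>1: "\<eta> x = 1" if "\<bar>x\<bar> \<le> r" for x
    using that \<sigma> u(2) by (simp add: \<eta>_def)
  have \<eta>0: "\<eta> x = 0" if "\<bar>x\<bar> \<ge> R" for x
    using that \<sigma> u(2,3) by (cases "x \<ge> 0") (auto simp: \<eta>_def)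
  have \<eta>supp: "support_on UNIV \<eta> \<subseteq> {-R..R}"
    using \<eta>0 by (force simp: support_on_def)
  have [measurable]: "\<eta> \<in> borel_measurable borel" by (rule smooth_measurable[OF \<eta>])
  obtain C where C: "C > 0" "\<And>\<xi>. norm (fourier \<eta> \<xi>) \<le> C / (1 + \<xi>\<^sup>2)"
    using fourier_decay[OF \<eta> \<eta>supp] by blast
  define T where "T = fourier_distr (function_distr f)"
  have T: "T \<phi> = (\<integral>x. f x * fourier \<phi> x \<partial>lborel)" for \<phi>
    by (simp add: T_def fourier_distr_def function_distr_def)
  have T_add: "T (\<lambda>x. \<phi> x + \<psi> x) = T \<phi> + T \<psi>"
    if "\<phi> \<in> test_functions UNIV" "\<psi> \<in> test_functions UNIV" for \<phi> \<psi>
    unfolding T fourier_add[OF that] distrib_left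
    by (intro Bochner_Integration.integral_add Lp_times_fourier_integrable[OF _ p f] that) auto
  have T_vanish: "T \<phi> = 0"
    if "smooth \<phi>" "\<And>x. x \<notin> {a..b} \<Longrightarrow> \<phi> x = 0" "a \<le> b" "{a..b} \<inter> {-\<sigma>..\<sigma>} = {}" for \<phi> a b
    by (rule supp_distr_vanish_interval[where T = T and a = a and b = b])
      (use supp that T_add in \<open>auto simp: T_def\<close>)
  define E where "E x = exp (\<i> * x0 * complex_of_real x)" for x
  have E: "smooth E" unfolding E_def by (rule smooth_exp_linear)
  have "(\<lambda>n. \<integral>x. f x * (of_nat (Suc n) * fourier \<eta> (real (Suc n) * (x - x0))) \<partial>lborel)
      \<longlonglongrightarrow> f x0 * (\<integral>x. fourier \<eta> x \<partial>lborel)"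
    by (rule approximate_identity[OF cont _ p f C(2)]) (use C in auto)
  moreover have "\<forall>\<^sub>F n in sequentially.
      (\<integral>x. f x * (of_nat (Suc n) * fourier \<eta> (real (Suc n) * (x - x0))) \<partial>lborel)
      = (\<integral>x. f x * fourier \<eta> (x - x0) \<partial>lborel)"
  proof -
    \<comment> \<open>From here on \<open>m * r > R\<close>, so \<open>\<eta> (x / m) = 1\<close> on
      the whole interval \<open>\<bar>x\<bar> \<le> R\<close> that carries
      \<open>\<eta>\<close>.\<close>
    obtain n0 where n0: "R / r < real n0" using reals_Archimedean2 by blast
    show ?thesis
    proof (rule eventually_sequentiallyI[of n0])
      fix n assume "n0 \<le> n"
      define m where "m = real (Suc n)"
      have m: "m \<ge> 1" "R / r < m"
        using n0 \<open>n0 \<le> n\<close> by (auto simp: m_def)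
      then have mr: "R < m * r" using \<sigma> by (simp add: field_simps)
      have "R \<le> m * R" using m \<sigma> by simp
      then have mR: "R \<le> m * R" "r \<le> m * R" using \<sigma> by linarith+
      define z where "z x = \<eta> (x / m) * E x" for x
      have z: "smooth z"
        using smooth_affine[OF \<eta>, of "1 / m" 0] unfolding z_def by (intro smooth_mult E) simp
      have z0: "z x = 0" if "x \<notin> {- (m * R)..m * R}" for x
      proof -
        have "R \<le> \<bar>x / m\<bar>" using that m by (auto simp: abs_if field_simps)
        then show ?thesis by (simp add: z_def \<eta>0)
      qed
      have zu: "smooth (\<lambda>x. z x * \<eta> x)" "smooth (\<lambda>x. z x * u x)" "smooth (\<lambda>x. z x * u (- x))"
        by (intro smooth_mult z \<eta> u(1) um)+
      have test: "\<phi> \<in> test_functions UNIV" if "smooth \<phi>" "\<And>x. z x = 0 \<Longrightarrow> \<phi> x = 0" for \<phi>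
        by (rule test_functionsI[OF that(1), of "- (m * R)" "m * R"]) (use that(2) z0 in auto)
      \<comment> \<open>The identity \<open>1 = \<eta> x + u x + u (- x)\<close> splits
        \<open>z\<close>; the last two pieces are carried by \<open>{r..m * R}\<close> and its
        mirror image, where the distribution vanishes.\<close>
      have "T z = T (\<lambda>x. z x * \<eta> x + (z x * u x + z x * u (- x)))"
        by (simp add: \<eta>_def algebra_simps)
      also have "\<dots> = T (\<lambda>x. z x * \<eta> x) + (T (\<lambda>x. z x * u x) + T (\<lambda>x. z x * u (- x)))"
        by (subst T_add T_add[of "\<lambda>x. z x * u x"], (intro test smooth_add zu; simp)+)+ simp
      also have "T (\<lambda>x. z x * u x) = 0"
        by (rule T_vanish[OF zu(2), of r "m * R"]) (use z0 u(2) \<sigma> mR in \<open>auto simp: not_le\<close>)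
      also have "T (\<lambda>x. z x * u (- x)) = 0"
        by (rule T_vanish[OF zu(3), of "- (m * R)" "- r"]) (use z0 u(2) \<sigma> mR in \<open>auto simp: not_le\<close>)
      \<comment> \<open>The form \<open>x / 1\<close> exhibits the result as the case
        \<open>m = 1\<close> of \<open>fourier_dilate_modulate\<close>.\<close>
      also have "(\<lambda>x. z x * \<eta> x) = (\<lambda>x. \<eta> (x / 1) * E x)"
      proof
        fix x show "z x * \<eta> x = \<eta> (x / 1) * E x"
        proof (cases "\<bar>x\<bar> \<le> R")
          case True
          then have "\<bar>x / m\<bar> \<le> r" using mr m by (simp add: abs_divide divide_le_eq mult.commute)
          then show ?thesis by (simp add: z_def \<eta>1)
        qed (simp add: \<eta>0)
      qed
      finally have "T z = T (\<lambda>x. \<eta> (x / 1) * E x)" by simp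
      then show "(\<integral>x. f x * (of_nat (Suc n) * fourier \<eta> (real (Suc n) * (x - x0))) \<partial>lborel)
          = (\<integral>x. f x * fourier \<eta> (x - x0) \<partial>lborel)"
        using m fourier_dilate_modulate[of m \<eta> x0] fourier_dilate_modulate[of 1 \<eta> x0]
        unfolding T z_def E_def by (simp add: m_def)
    qed
  qed
  ultimately have "(\<lambda>n. \<integral>x. f x * fourier \<eta> (x - x0) \<partial>lborel) \<longlonglongrightarrow> f x0 * (\<integral>x. fourier \<eta> x \<partial>lborel)"
    by (rule Lim_transform_eventually)
  then have "f x0 * (\<integral>x. fourier \<eta> x \<partial>lborel) = (\<integral>x. f x * fourier \<eta> (x - x0) \<partial>lborel)"
    by (simp add: LIMSEQ_const_iff)
  moreover have "\<eta> 0 = 1" using \<sigma> by (intro \<eta>1) auto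
  ultimately show ?thesis
    by (simp add: integral_fourier[OF \<eta> \<eta>supp] mult.commute)
qed

text \<open>The reproducing formula is estimated by \<open>Lp_times_decaying\<close> with
  \<open>t\<close> equal to the norm of \<open>f\<close>: the quotient of integral and
  \<open>t powr r\<close> becomes 1, whence \<open>pi + 1\<close> in the constant. The same
  \<open>\<eta>\<close> serves all \<open>p\<close> and \<open>f\<close>.\<close>

lemma bernstein_pointwise_bound:
  assumes "\<sigma> > 0"
  obtains C where "C > 0"
    "\<And>p f x. 1 \<le> p \<Longrightarrow> p \<noteq> \<infinity> \<Longrightarrow> f \<in> bernstein p \<sigma> \<Longrightarrow> norm (f x) \<le> C * Lp_norm p f"
proof -
  obtain u where u: "smooth u" "\<And>x. x \<le> \<sigma> + 1 \<Longrightarrow> u x = 0" "\<And>x. x \<ge> \<sigma> + 2 \<Longrightarrow> u x = 1"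
    by (rule smooth_cutoff_exists[of "\<sigma> + 1" "\<sigma> + 2"]) auto
  define \<eta> where "\<eta> = (\<lambda>x. 1 - (u x + u (- x)))"
  have \<eta>: "smooth \<eta>" unfolding \<eta>_def
    using smooth_affine[OF u(1), of "-1" 0] by (intro smooth_diff smooth_add smooth_const u(1)) simp
  have [measurable]: "\<eta> \<in> borel_measurable borel" by (rule smooth_measurable[OF \<eta>])
  have "support_on UNIV \<eta> \<subseteq> {- (\<sigma> + 2)..\<sigma> + 2}"
  proof
    fix x assume "x \<in> support_on UNIV \<eta>"
    then have "\<not> (\<sigma> + 2 \<le> \<bar>x\<bar>)"
      using u(2)[of x] u(2)[of "- x"] u(3)[of x] u(3)[of "- x"] assms
      by (cases "x \<ge> 0") (auto simp: support_on_def \<eta>_def)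
    then show "x \<in> {- (\<sigma> + 2)..\<sigma> + 2}" by auto
  qed
  then obtain C where C: "C > 0" "\<And>\<xi>. norm (fourier \<eta> \<xi>) \<le> C / (1 + \<xi>\<^sup>2)"
    using fourier_decay[OF \<eta>] by blast
  show ?thesis
  proof (rule that)
    show "C * (pi + 1) / sqrt (2 * pi) > 0"
      using C(1) by (simp add: add_pos_pos)
    fix p :: ennreal and f x
    assume p: "1 \<le> p" "p \<noteq> \<infinity>" and f: "f \<in> bernstein p \<sigma>"
    define r where "r = enn2real p"
    have r: "r \<ge> 1"
      using p enn2real_mono[of 1 p] by (simp add: r_def top.not_eq_extremum)
    have fs: "smooth f" "supp_distr (fourier_distr (function_distr f)) \<subseteq> {-\<sigma>..\<sigma>}"
      and fi: "integrable lborel (\<lambda>x. norm (f x) powr r)"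
      using f p by (auto simp: bernstein_def Lp_space_def r_def)
    define I where "I = (\<integral>x. norm (f x) powr r \<partial>lborel)"
    have "I \<ge> 0" by (simp add: I_def)
    have bound: "sqrt (2 * pi) * norm (f x) \<le> C * t * (pi + I / t powr r)" if "t > 0" for t
    proof -
      have "sqrt (2 * pi) * norm (f x) = norm (sqrt (2 * pi) * f x)"
        by (simp add: norm_mult)
      also have "sqrt (2 * pi) * f x = (\<integral>y. f y * fourier \<eta> (y - x) \<partial>lborel)"
        by (rule reproducing_formula[OF smooth_continuous_on[OF fs(1)] r fi fs(2) assms _ _ u \<eta>_def]) auto
      also have "norm \<dots> \<le> C * t * (pi + I / t powr r)"
        unfolding I_def
        by (rule Lp_times_decaying(2)[where K = "\<lambda>y. fourier \<eta> (y - x)", OF smooth_measurable[OF fs(1)] _ r fi C(2)])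
          (use C(1) that in auto)
      finally show ?thesis .
    qed
    define N where "N = I powr (1 / r)"
    have "sqrt (2 * pi) * norm (f x) \<le> C * (pi + 1) * N"
    proof (cases "I = 0")
      case True
      \<comment> \<open>The norm is 0 here and cannot serve as \<open>t\<close>; letting
        \<open>t\<close> tend to 0 from the right gives the bound instead.\<close>
      have "sqrt (2 * pi) * norm (f x) \<le> 0"
      proof (rule tendsto_lowerbound)
        show "((\<lambda>t. C * t * pi) \<longlongrightarrow> 0) (at_right 0)"
          by (auto intro!: tendsto_eq_intros)
        show "\<forall>\<^sub>F t in at_right 0. sqrt (2 * pi) * norm (f x) \<le> C * t * pi"
          using bound True by (auto simp: eventually_at_filter)
      qed auto
      then show ?thesis using True by (simp add: N_def)
    next
      case False
      then have "N > 0" "N powr r = I"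
        using \<open>I \<ge> 0\<close> r by (auto simp: N_def powr_powr)
      then show ?thesis
        using bound[of N] False by (simp add: mult_ac)
    qed
    moreover have "Lp_norm p f = N"
      using p by (simp add: Lp_norm_def N_def I_def r_def)
    ultimately show "norm (f x) \<le> C * (pi + 1) / sqrt (2 * pi) * Lp_norm p f"
      by (simp add: field_simps)
  qed
qed

lemma Lp_embedding_of_bounded:
  fixes f :: "real \<Rightarrow> complex"
  assumes pq: "1 \<le> p" "p \<le> q" "p \<noteq> \<infinity>" and f: "f \<in> Lp_space p"
    and bound: "\<And>x. norm (f x) \<le> C * Lp_norm p f" and "C > 0"
  shows "f \<in> Lp_space q" "Lp_norm q f \<le> (if q = \<infinity> then C else C powr (1 - enn2real p / enn2real q)) * Lp_norm p f"
proof -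
  define a N where "a = enn2real p" and "N = Lp_norm p f"
  have a: "a \<ge> 1"
    using pq enn2real_mono[of 1 p] by (simp add: a_def top.not_eq_extremum)
  have [measurable]: "f \<in> borel_measurable borel" using f by (simp add: Lp_space_def)
  have fi: "integrable lborel (\<lambda>x. norm (f x) powr a)"
    using f pq by (simp add: Lp_space_def a_def)
  have N: "N = (\<integral>x. norm (f x) powr a \<partial>lborel) powr (1 / a)"
    using pq by (simp add: N_def Lp_norm_def a_def)
  then have "N \<ge> 0" by simp
  have Na: "(\<integral>x. norm (f x) powr a \<partial>lborel) = N powr a"
    unfolding N using a by (simp add: powr_powr)
  have le: "norm (f x) \<le> C * N" for x using bound by (simp add: N_def)
  have "f \<in> Lp_space q \<and> Lp_norm q f \<le> (if q = \<infinity> then C else C powr (1 - a / enn2real q)) * N"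
  proof (cases "q = \<infinity>")
    case True
    \<comment> \<open>For an infinite target exponent the pointwise bound is already the norm
      estimate.\<close>
    have "esssup lborel (\<lambda>x. ennreal (norm (f x))) \<le> ennreal (C * N)"
      by (rule esssup_I) (auto intro!: AE_I2 ennreal_leI le)
    then show ?thesis
      using True \<open>N \<ge> 0\<close> \<open>C > 0\<close>
      by (auto simp: Lp_space_def Lp_norm_def less_top[symmetric] top_unique intro!: enn2real_leI)
  next
    case False
    define b where "b = enn2real q"
    have b: "a \<le> b"
      using pq False by (auto simp: a_def b_def top.not_eq_extremum intro!: enn2real_mono)
    have pt: "norm (f x) powr b \<le> (C * N) powr (b - a) * norm (f x) powr a" for x
    proof -
      have "norm (f x) powr b = norm (f x) powr (b - a) * norm (f x) powr a"
        by (simp flip: powr_add)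
      also have "\<dots> \<le> (C * N) powr (b - a) * norm (f x) powr a"
        using le b by (intro mult_right_mono powr_mono2) auto
      finally show ?thesis .
    qed
    have fi': "integrable lborel (\<lambda>x. (C * N) powr (b - a) * norm (f x) powr a)"
      by (intro integrable_mult_right fi)
    have fb: "integrable lborel (\<lambda>x. norm (f x) powr b)"
      by (rule Bochner_Integration.integrable_bound[OF fi']) (use pt in auto)
    have "(\<integral>x. norm (f x) powr b \<partial>lborel) \<le> (\<integral>x. (C * N) powr (b - a) * norm (f x) powr a \<partial>lborel)"
      by (intro integral_mono fb fi' pt)
    also have "\<dots> = (C * N) powr (b - a) * N powr a"
      by (simp add: Na)
    also have "\<dots> = C powr (b - a) * N powr b"
      using \<open>C > 0\<close> \<open>N \<ge> 0\<close> by (simp add: powr_mult mult.assoc flip: powr_add)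
    finally have "(\<integral>x. norm (f x) powr b \<partial>lborel) powr (1 / b) \<le> (C powr (b - a) * N powr b) powr (1 / b)"
      using a b by (intro powr_mono2) auto
    \<comment> \<open>Taking the \<open>b\<close>-th root turns the exponent \<open>b - a\<close> of
      \<open>C\<close> into \<open>1 - a / b\<close> and makes the estimate homogeneous of degree 1
      in \<open>N\<close>.\<close>
    also have "\<dots> = C powr (1 - a / b) * N"
      using a b \<open>C > 0\<close> \<open>N \<ge> 0\<close> by (simp add: powr_mult powr_powr diff_divide_distrib)
    finally show ?thesis
      using False fb by (simp add: Lp_space_def Lp_norm_def b_def)
  qed
  then show "f \<in> Lp_space q"
    "Lp_norm q f \<le> (if q = \<infinity> then C else C powr (1 - enn2real p / enn2real q)) * Lp_norm p f"
    by (auto simp: a_def N_def)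
qed

text \<open>Smoothness and the spectral condition do not involve the exponent, so only integrability
  and the norm estimate have to be transferred. All three inclusions of the theorem are
  instances.\<close>

lemma bernstein_embedding:
  assumes "\<sigma> > 0" "1 \<le> p" "p \<le> q"
  shows "continuously_embedded (bernstein p \<sigma>) (Lp_norm p) (bernstein q \<sigma>) (Lp_norm q)"
proof (cases "p = \<infinity>")
  case True
  then have "q = p" using assms by (simp add: top_unique)
  then show ?thesis
    by (auto simp: continuously_embedded_def intro!: exI[of _ 1])
next
  case False
  obtain C where C: "C > 0"
    "\<And>f x. f \<in> bernstein p \<sigma> \<Longrightarrow> norm (f x) \<le> C * Lp_norm p f"
    using bernstein_pointwise_bound[OF assms(1)] assms(2) False by metis
  have "f \<in> Lp_space q \<and>
      Lp_norm q f \<le> (if q = \<infinity> then C else C powr (1 - enn2real p / enn2real q)) * Lp_norm p f"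
    if "f \<in> bernstein p \<sigma>" for f
    using Lp_embedding_of_bounded[OF assms(2,3) False _ C(2)[OF that] C(1)] that
    by (auto simp: bernstein_def)
  then show ?thesis
    unfolding continuously_embedded_def by (auto simp: bernstein_def)
qed

theorem corollary3p1:
  fixes \<sigma> :: real and p q :: ennreal
  assumes "\<sigma> > 0" and "1 \<le> p" and "p \<le> q"
  shows "continuously_embedded (bernstein 1 \<sigma>) (Lp_norm 1) (bernstein p \<sigma>) (Lp_norm p)
       \<and> continuously_embedded (bernstein p \<sigma>) (Lp_norm p) (bernstein q \<sigma>) (Lp_norm q)
       \<and> continuously_embedded (bernstein q \<sigma>) (Lp_norm q) (bernstein \<infinity> \<sigma>) (Lp_norm \<infinity>)"
  using assms by (intro conjI bernstein_embedding) (auto intro: order_trans)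

end
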